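(* Consider a VRPSD instance under the detour-to-depot (DTD) policy. If the instance satisfies the monotonicity property, then the superadditivity property holds for the DTD recourse: $\mathcal{Q}^{\text{DTD}}_{(p_1,p_2)}\ge\mathcal{Q}^{\text{DTD}}_{p_1}+\mathcal{Q}^{\text{DTD}}_{p_2}$ for all $p_1,p_2\in\mathcal{P}$ such that the concatenation $(p_1,p_2)\in\mathcal{P}$.
   Context: Let $N=\{1,\dots,n\}$ be customers, $0$ the depot, with symmetric non-negative travel costs $c_{i,j}$ on $\{0\}\cup N$ satisfying the triangle inequality. Demands $\xi_i$, $i\in N$, are independent non-negative random variables with finite means $\mu_i$; $Q>0$ is the vehicle capacity; $f>0$ is the load factor, with $\max_i\mu_i\le fQ$. The failure cost at customer $i$ is $c^F_i=b^F+2c_{0,i}$, where $b^F\ge0$. A path is a nonempty sequence $p=(i_1,\dots,i_t)$ of distinct customers, $N(p)$ its set of customers, and $\mathcal{P}=\{p:\sum_{i\in N(p)}\mu_i\le fQ\}$. For paths with disjoint customer sets, $(p_1,p_2)$ is their concatenation. DTD expected recourse cost: $\bar{\mathcal{Q}}^{\text{DTD}}_p=\sum_{j=1}^t\sum_{l=1}^{\infty}\mathbb{P}\left[\sum_{k=1}^{j-1}\xi_{i_k}\le lQ<\sum_{k=1}^{j}\xi_{i_k}\right]c^F_{i_j}$, and $\mathcal{Q}^{\text{DTD}}_p=\min\{\bar{\mathcal{Q}}^{\text{DTD}}_{(i_1,\dots,i_t)},\bar{\mathcal{Q}}^{\text{DTD}}_{(i_t,\dots,i_1)}\}$. Monotonicity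 property: for every $S\subseteq N$ with $|S|\ge2$ and $\sum_{i\in S}\mu_i\le fQ$, every $a,b\in S$ with $a\ne b$, every $\widetilde{S}\subseteq S\setminus\{a,b\}$, and every integer $l\ge1$, $$\mathbb{P}\left[\sum_{i\in\widetilde{S}\cup\{a\}}\xi_i\le lQ<\sum_{i\in\widetilde{S}\cup\{a,b\}}\xi_i\right]\ge\mathbb{P}\left[\sum_{i\in\widetilde{S}}\xi_i\le lQ<\sum_{i\in\widetilde{S}\cup\{b\}}\xi_i\right].$$ *)

theory Defs
  imports "HOL-Probability.Probability"
begin

text \<open>
  An instance of the vehicle routing problem with stochastic demands: the depot is \<open>0\<close>, the
  customers are \<open>1, \<dots>, n\<close>, and \<open>\<xi> i\<close> is the random demand of customer \<open>i\<close>, with all demands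
  living on a common probability space \<open>M\<close>. Values of \<open>c\<close> and \<open>\<xi>\<close> outside the index range are
  irrelevant. Measurability of the demands is part of \<open>indep_vars\<close>.
\<close>

locale vrpsd = prob_space M for M :: "'w measure" +
  fixes n :: nat
    and c :: "nat \<Rightarrow> nat \<Rightarrow> real"
    and \<xi> :: "nat \<Rightarrow> 'w \<Rightarrow> real"
    and Q f bF :: real
  assumes cost_nonneg: "\<And>i j. i \<in> {0..n} \<Longrightarrow> j \<in> {0..n} \<Longrightarrow> 0 \<le> c i j"
    and cost_sym: "\<And>i j. i \<in> {0..n} \<Longrightarrow> j \<in> {0..n} \<Longrightarrow> c i j = c j i"
    and cost_triangle:
      "\<And>i j k. i \<in> {0..n} \<Longrightarrow> j \<in> {0..n} \<Longrightarrow> k \<in> {0..n} \<Longrightarrow> c i k \<le> c i j + c j k"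
    and demands_indep: "indep_vars (\<lambda>_. borel) \<xi> {1..n}"
    and demands_nonneg: "\<And>i. i \<in> {1..n} \<Longrightarrow> AE \<omega> in M. 0 \<le> \<xi> i \<omega>"
    and demands_integrable: "\<And>i. i \<in> {1..n} \<Longrightarrow> integrable M (\<xi> i)"
    and capacity_pos: "0 < Q"
    and load_factor_pos: "0 < f"
    and mean_le: "\<And>i. i \<in> {1..n} \<Longrightarrow> expectation (\<xi> i) \<le> f * Q"
    and bF_nonneg: "0 \<le> bF"
begin

definition paths :: "nat list set" where
  "paths = {p. p \<noteq> [] \<and> distinct p \<and> set p \<subseteq> {1..n} \<and>
               (\<Sum>i\<in>set p. expectation (\<xi> i)) \<le> f * Q}"

definition failure_cost :: "nat \<Rightarrow> real" where
  "failure_cost i = bF + 2 * c 0 i"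

text \<open>
  Lists are indexed from \<open>0\<close>, so \<open>p ! j\<close> is the \<open>(j + 1)\<close>-st customer of the path, and the
  customers visited before it are \<open>p ! k\<close> for \<open>k < j\<close>. The series over \<open>l \<ge> 1\<close> is written as a
  series over all naturals with \<open>Suc l\<close> in place of \<open>l\<close>.
  It converges because the number of indices with
  \<open>x \<le> l * Q < x + y\<close> is at most \<open>y / Q + 1\<close> for \<open>y \<ge> 0\<close> and the demands have finite means.
\<close>

definition DTD_directed_cost :: "nat list \<Rightarrow> real" where
  "DTD_directed_cost p =
     (\<Sum>j<length p. \<Sum>l.
        prob {\<omega> \<in> space M. (\<Sum>k<j. \<xi> (p ! k) \<omega>) \<le> real (Suc l) * Q \<and>
                          real (Suc l) * Q < (\<Sum>k\<le>j. \<xi> (p ! k) \<omega>)}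
        * failure_cost (p ! j))"

definition DTD_cost :: "nat list \<Rightarrow> real" where
  "DTD_cost p = min (DTD_directed_cost p) (DTD_directed_cost (rev p))"

definition monotonicity_property :: bool where
  "monotonicity_property \<longleftrightarrow>
     (\<forall>S. S \<subseteq> {1..n} \<and> 2 \<le> card S \<and> (\<Sum>i\<in>S. expectation (\<xi> i)) \<le> f * Q \<longrightarrow>
        (\<forall>a\<in>S. \<forall>b\<in>S. a \<noteq> b \<longrightarrow>
          (\<forall>T. T \<subseteq> S - {a, b} \<longrightarrow>
            (\<forall>l::nat. 1 \<le> l \<longrightarrow>
              prob {\<omega> \<in> space M. (\<Sum>i\<in>T \<union> {a}. \<xi> i \<omega>) \<le> real l * Q \<and>
                                real l * Q < (\<Sum>i\<in>T \<union> {a, b}. \<xi> i \<omega>)}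
              \<ge> prob {\<omega> \<in> space M. (\<Sum>i\<in>T. \<xi> i \<omega>) \<le> real l * Q \<and>
                                  real l * Q < (\<Sum>i\<in>T \<union> {b}. \<xi> i \<omega>)}))))"

end

end

theory Submission
  imports Defs
begin

text \<open>
  The expected number of failures at a customer depends only on the set of customers visited
  before it, and by the monotonicity property it grows with that set. Prepending \<open>p\<close> to \<open>q\<close>
  therefore cannot decrease the directed cost of \<open>q\<close>, so the directed cost is superadditive under
  concatenation. The same holds for the reversed path \<open>rev q @ rev p\<close>, and the minimum of the
  two directions inherits superadditivity.
\<close>

text \<open>At each outcome at most \<open>\<bar>Z \<omega>\<bar> / Q\<close> positive multiples of
  \<open>Q\<close> lie below \<open>Z \<omega>\<close>, so every partial sum is bounded by the
  expectation of that quotient. The absolute value is there because \<open>Z\<close> may be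
  negative.\<close>

lemma (in prob_space) summable_prob_multiples_less:
  fixes Z :: "'a \<Rightarrow> real"
  assumes Z: "integrable M Z" and Q: "0 < Q"
  shows "summable (\<lambda>l. prob {\<omega> \<in> space M. real (Suc l) * Q < Z \<omega>})"
proof (rule bounded_imp_summable)
  fix m :: nat
  have [measurable]: "Z \<in> borel_measurable M"
    using Z by simp
  have count: "(\<Sum>l\<le>m. indicator {\<omega> \<in> space M. real (Suc l) * Q < Z \<omega>} \<omega>) \<le> \<bar>Z \<omega>\<bar> / Q"
    if "\<omega> \<in> space M" for \<omega>
  proof -
    have sub: "{l. l \<le> m \<and> real (Suc l) * Q < Z \<omega>} \<subseteq> {..<nat \<lfloor>\<bar>Z \<omega>\<bar> / Q\<rfloor>}"
    proof
      fix l assume "l \<in> {l. l \<le> m \<and> real (Suc l) * Q < Z \<omega>}"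
      then have "real (Suc l) \<le> \<bar>Z \<omega>\<bar> / Q"
        using Q abs_ge_self[of "Z \<omega>"] by (simp add: pos_le_divide_eq)
      then show "l \<in> {..<nat \<lfloor>\<bar>Z \<omega>\<bar> / Q\<rfloor>}"
        by (simp add: Suc_le_lessD le_nat_floor)
    qed
    have "(\<Sum>l\<le>m. indicator {\<omega> \<in> space M. real (Suc l) * Q < Z \<omega>} \<omega>)
        = (\<Sum>l\<le>m. if real (Suc l) * Q < Z \<omega> then 1 else 0 :: real)"
      using that by (intro sum.cong) (auto simp: indicator_def)
    also have "\<dots> = real (card {l. l \<le> m \<and> real (Suc l) * Q < Z \<omega>})"
      by (simp add: sum.If_cases Int_def)
    also have "\<dots> \<le> real (nat \<lfloor>\<bar>Z \<omega>\<bar> / Q\<rfloor>)"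
      using card_mono[OF finite_lessThan sub] by simp
    also have "\<dots> \<le> \<bar>Z \<omega>\<bar> / Q"
      using Q by simp
    finally show ?thesis .
  qed
  \<comment> \<open>A finite sum of probabilities is the expectation of the number of events that
    occur, which \<open>count\<close> bounds pointwise.\<close>
  have "(\<Sum>l\<le>m. prob {\<omega> \<in> space M. real (Suc l) * Q < Z \<omega>})
      = expectation (\<lambda>\<omega>. \<Sum>l\<le>m. indicator {\<omega> \<in> space M. real (Suc l) * Q < Z \<omega>} \<omega>)"
    by (subst Bochner_Integration.integral_sum) (auto intro: integrable_indicator simp: emeasure_eq_measure)
  also have "\<dots> \<le> expectation (\<lambda>\<omega>. \<bar>Z \<omega>\<bar> / Q)"
    using count Z
    by (intro integral_mono Bochner_Integration.integrable_sum)
       (auto simp: emeasure_eq_measure)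
  finally show "(\<Sum>l\<le>m. prob {\<omega> \<in> space M. real (Suc l) * Q < Z \<omega>})
      \<le> expectation (\<lambda>\<omega>. \<bar>Z \<omega>\<bar> / Q)" .
qed simp

context vrpsd
begin

text \<open>Taking a set of earlier customers instead of a path prefix matches the form of
  \<open>monotonicity_property\<close>.\<close>

definition failure_prob :: "nat set \<Rightarrow> nat \<Rightarrow> nat \<Rightarrow> real" where
  "failure_prob T b l =
     prob {\<omega> \<in> space M. (\<Sum>i\<in>T. \<xi> i \<omega>) \<le> real (Suc l) * Q \<and>
                       real (Suc l) * Q < (\<Sum>i\<in>insert b T. \<xi> i \<omega>)}"

lemma failure_cost_nonneg: "i \<in> {1..n} \<Longrightarrow> 0 \<le> failure_cost i"
  unfolding failure_cost_def using bF_nonneg cost_nonneg[of 0 i] by simp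

text \<open>The failure event forces the total demand of \<open>insert b T\<close>, an integrable
  variable, above the same multiple of \<open>Q\<close>.\<close>

lemma summable_failure_prob:
  assumes "insert b T \<subseteq> {1..n}"
  shows "summable (failure_prob T b)"
proof (rule summable_comparison_test')
  have int: "integrable M (\<lambda>\<omega>. \<Sum>i\<in>insert b T. \<xi> i \<omega>)"
    using assms demands_integrable by (intro Bochner_Integration.integrable_sum) auto
  then have [measurable]: "(\<lambda>\<omega>. \<Sum>i\<in>insert b T. \<xi> i \<omega>) \<in> borel_measurable M"
    by simp
  show "summable (\<lambda>l. prob {\<omega> \<in> space M. real (Suc l) * Q < (\<Sum>i\<in>insert b T. \<xi> i \<omega>)})"
    by (rule summable_prob_multiples_less[OF int capacity_pos])
  show "norm (failure_prob T b l)
      \<le> prob {\<omega> \<in> space M. real (Suc l) * Q < (\<Sum>i\<in>insert b T. \<xi> i \<omega>)}" for l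
    unfolding failure_prob_def by (auto intro!: finite_measure_mono)
qed

text \<open>The monotonicity property adds one customer at a time; induction adds all of
  \<open>U - T\<close>, with \<open>S\<close> fixed as the ambient set that respects the load
  bound.\<close>

lemma failure_prob_mono:
  assumes "monotonicity_property"
    and S: "S \<subseteq> {1..n}" "(\<Sum>i\<in>S. expectation (\<xi> i)) \<le> f * Q"
    and "b \<in> S" "b \<notin> U" "U \<subseteq> S" "T \<subseteq> U"
  shows "failure_prob T b l \<le> failure_prob U b l"
proof -
  have finS: "finite S"
    using S(1) finite_subset by blast
  \<comment> \<open>Disjointness from \<open>T\<close> ensures that each added customer is new, as
    the condition \<open>T \<union> A \<subseteq> S - {a, b}\<close> demands.\<close>
  have "failure_prob T b l \<le> failure_prob (T \<union> A) b l"
    if "finite A" "A \<subseteq> S" "b \<notin> A" "A \<inter> T = {}" for A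
    using that
  proof (induction A rule: finite_induct)
    case (insert a A)
    have "card {a, b} \<le> card S"
      using insert.prems assms finS by (intro card_mono) auto
    then have "2 \<le> card S"
      using insert.prems by auto
    moreover have "T \<union> A \<subseteq> S - {a, b}"
      using insert.prems insert.hyps assms by auto
    moreover have "a \<in> S" "a \<noteq> b"
      using insert.prems by auto
    ultimately have "failure_prob (T \<union> A) b l \<le> failure_prob (insert a (T \<union> A)) b l"
      using assms(1)[unfolded monotonicity_property_def, rule_format, of S a b "T \<union> A" "Suc l"]
        S \<open>b \<in> S\<close>
      by (simp add: failure_prob_def insert_commute)
    with insert show ?case
      by simp
  qed simp
  from this[of "U - T"] show ?thesis
    using assms finS finite_subset[of "U - T" S] by (auto simp: Un_absorb1)
qed

text \<open>Distinctness makes positions and customers correspond bijectively, so sums over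
  positions become sums over sets.\<close>

lemma DTD_directed_cost_eq:
  assumes "distinct p"
  shows "DTD_directed_cost p =
    (\<Sum>j<length p. \<Sum>l. failure_prob (set (take j p)) (p ! j) l * failure_cost (p ! j))"
proof -
  have prefix: "(\<Sum>k<j. \<xi> (p ! k) \<omega>) = (\<Sum>i\<in>set (take j p). \<xi> i \<omega>)" if "j \<le> length p" for j \<omega>
  proof (rule sum.reindex_bij_betw)
    show "bij_betw ((!) p) {..<j} (set (take j p))"
      using that assms
      by (auto simp: bij_betw_def inj_on_def nth_eq_iff_index_eq lessThan_atLeast0 nth_image)
  qed
  have "(\<Sum>k\<le>j. \<xi> (p ! k) \<omega>) = (\<Sum>i\<in>insert (p ! j) (set (take j p)). \<xi> i \<omega>)"
    if "j < length p" for j \<omega>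
    using prefix[of "Suc j" \<omega>] that by (simp add: lessThan_Suc_atMost take_Suc_conv_app_nth)
  with prefix show ?thesis
    unfolding DTD_directed_cost_def failure_prob_def by simp
qed

lemma sum_lessThan_add:
  fixes g :: "nat \<Rightarrow> real"
  shows "(\<Sum>j<m + k. g j) = (\<Sum>j<m. g j) + (\<Sum>j<k. g (m + j))"
  by (induction k) (auto simp: add.assoc)

lemma DTD_directed_cost_append:
  assumes mono: "monotonicity_property" and pq: "p @ q \<in> paths"
  shows "DTD_directed_cost p + DTD_directed_cost q \<le> DTD_directed_cost (p @ q)"
proof -
  have dist: "distinct (p @ q)" and sub: "set (p @ q) \<subseteq> {1..n}"
    and load: "(\<Sum>i\<in>set (p @ q). expectation (\<xi> i)) \<le> f * Q"
    using pq by (auto simp: paths_def)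
  have le: "(\<Sum>l. failure_prob (set (take j q)) (q ! j) l * failure_cost (q ! j))
      \<le> (\<Sum>l. failure_prob (set p \<union> set (take j q)) (q ! j) l * failure_cost (q ! j))"
    if j: "j < length q" for j
  proof -
    have mem: "q ! j \<in> set q" and pre: "set (take j q) \<subseteq> set q"
      using j by (auto dest: in_set_takeD)
    have "q ! j \<notin> set (take j q)"
      using j dist by (auto simp: in_set_conv_nth nth_eq_iff_index_eq)
    with mem dist have "q ! j \<notin> set p \<union> set (take j q)"
      by auto
    then have "failure_prob (set (take j q)) (q ! j) l
        \<le> failure_prob (set p \<union> set (take j q)) (q ! j) l" for l
      using mem pre by (intro failure_prob_mono[OF mono sub load]) auto
    moreover have "0 \<le> failure_cost (q ! j)"
      using mem sub by (intro failure_cost_nonneg) auto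
    moreover have "insert (q ! j) (set (take j q)) \<subseteq> {1..n}"
      "insert (q ! j) (set p \<union> set (take j q)) \<subseteq> {1..n}"
      using mem pre sub by auto
    \<comment> \<open>Termwise comparison of the two infinite sums requires both series to be
      summable.\<close>
    ultimately show ?thesis
      by (intro suminf_le summable_mult2 summable_failure_prob mult_right_mono)
  qed
  show ?thesis
    \<comment> \<open>Splitting the positions at \<open>length p\<close>, the first block has the
      same prefixes as in \<open>p\<close> and cancels; \<open>le\<close> handles the second
      block.\<close>
    using dist le
    by (auto simp: DTD_directed_cost_eq sum_lessThan_add nth_append intro!: sum_mono)
qed

lemma DTD_cost_append:
  assumes "monotonicity_property" "p @ q \<in> paths"
  shows "DTD_cost p + DTD_cost q \<le> DTD_cost (p @ q)"
proof -
  \<comment> \<open>This is \<open>rev (p @ q)\<close>. Whichever direction attains the minimum for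
    \<open>p @ q\<close>, the costs of \<open>p\<close> and \<open>q\<close> in that same direction
    bound their minima from above.\<close>
  have "rev q @ rev p \<in> paths"
    using assms(2) by (auto simp: paths_def Un_commute)
  from DTD_directed_cost_append[OF assms(1) this] DTD_directed_cost_append[OF assms]
  show ?thesis
    by (simp add: DTD_cost_def min_def)
qed

end

theorem theorem2:
  fixes M :: "'w measure"
    and n :: nat
    and c :: "nat \<Rightarrow> nat \<Rightarrow> real"
    and \<xi> :: "nat \<Rightarrow> 'w \<Rightarrow> real"
    and Q f bF :: real
  assumes "vrpsd M n c \<xi> Q f bF"
    and "vrpsd.monotonicity_property M n \<xi> Q f"
  shows "\<forall>p1 \<in> vrpsd.paths M n \<xi> Q f. \<forall>p2 \<in> vrpsd.paths M n \<xi> Q f.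
           p1 @ p2 \<in> vrpsd.paths M n \<xi> Q f \<longrightarrow>
           vrpsd.DTD_cost M c \<xi> Q bF (p1 @ p2)
             \<ge> vrpsd.DTD_cost M c \<xi> Q bF p1 + vrpsd.DTD_cost M c \<xi> Q bF p2"
  using vrpsd.DTD_cost_append[OF assms] by blast

end
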